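(* Let $H\in\mathbb{R}^{n\times n}$ be symmetric and let $c\in\mathbb{R}^n$, $c\neq 0$. Let $\theta_0,\dots,\theta_{r-1}$ be arbitrary nonzero real numbers and let $(q_k,y_k,\delta_k)$, $k=0,\dots,r$, be the unnormalized Lanczos triples generated from $H$, $c$ and the $\theta_k$ (defined in the context). Let $Z$ denote a matrix whose columns form an orthonormal basis for $\mathcal{N}(H)$. Then the following holds for the cases $\delta_r\neq 0$ and $\delta_r=0$ respectively. (a) If $\delta_r\neq 0$, then $Hx_r+c=0$ for $x_r=(1/\delta_r)y_r$, so that $c\in\mathcal{R}(H)$ and $x_r$ solves $Hx+c=0$. In addition, it holds that $Z^Ty_k=0$, $k=0,\dots,r$. (b) If $\delta_r=0$, then $y_r=\delta_r^{(1)}ZZ^Tc$, with $\delta_r^{(1)}\neq 0$ and $Z^Tc\neq 0$, so that $c\notin\mathcal{R}(H)$ and the system $Hx+c=0$ has no solution. Further, there is a $y_r^{(1)}\in\mathcal{K}_{r-1}(c,H)$ so that $y_r=Hy_r^{(1)}+\delta_r^{(1)}c$. Hence $H(Hx_r^{(1)}+c)=0$ for $x_r^{(1)}=(1/\delta_r^{(1)})y_r^{(1)}$, so that $x_r^{(1)}$ solves $\min_{x\in\mathbb{R}^n}\|Hx+c\|_2^2$.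
   Context: $\mathcal{N}(H)$ and $\mathcal{R}(H)$ denote the null space and range space of $H$; if $H$ is nonsingular, $Z$ is an empty matrix. All arithmetic is exact and norms are Euclidean. Krylov subspaces: $\mathcal{K}_0(c,H)=\{0\}$ and $\mathcal{K}_k(c,H)=\mathrm{span}\{c,Hc,\dots,H^{k-1}c\}$ for $k\geq 1$. $r$ denotes the smallest positive integer $k$ for which $\mathcal{K}_{k+1}(c,H)=\mathcal{K}_k(c,H)$. Unnormalized Lanczos triples: given nonzero reals $\theta_0,\dots,\theta_{r-1}$, set $(q_0,y_0,\delta_0)=(c,0,1)$, $$q_1=\theta_0(-Hq_0+\alpha_0q_0),\quad y_1=\theta_0(-q_0+\alpha_0y_0),\quad \delta_1=\theta_0\alpha_0\delta_0,$$ and for $k=1,\dots,r-1$, $$q_{k+1}=\theta_k(-Hq_k+\alpha_kq_k+\beta_{k-1}q_{k-1}),\quad y_{k+1}=\theta_k(-q_k+\alpha_ky_k+\beta_{k-1}y_{k-1}),\quad \delta_{k+1}=\theta_k(\alpha_k\delta_k+\beta_{k-1}\delta_{k-1}),$$ where $\alpha_k=\frac{q_k^THq_k}{q_k^Tq_k}$ for $k=0,\dots,r-1$ and $\beta_{k-1}=\frac{q_{k-1}^THq_k}{q_{k-1}^Tq_{k-1}}$ for $k=1,\dots,r-1$. These are well defined, with $q_k\in\mathcal{K}_{k+1}(c,H)\cap\mathcal{K}_k(c,H)^\perp$, $y_k\in\mathcal{K}_k(c,H)$ and $q_k=Hy_k+\delta_kc$; moreover $q_k\neq 0$ for $k<r$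 and $q_r=0$. Coefficients: for $k=1,\dots,r$, $y_k\in\mathcal{K}_k(c,H)$ is written uniquely (the vectors $c,Hc,\dots,H^{r-1}c$ being linearly independent) as $y_k=\sum_{j=1}^k\delta_k^{(j)}H^{j-1}c$. In particular $\delta_r^{(1)}$ is the coefficient of $c$ in $y_r$. *)

theory Defs
  imports "Jordan_Normal_Form.Matrix_Kernel"
begin

text \<open>
  Vectors and matrices are those of Jordan_Normal_Form, with dimensions as natural numbers, so that
  the matrix \<open>Z\<close> below may have zero columns.  Matrix and vector operations are only meaningful on
  the carriers.
\<close>

definition mat_range :: "real mat \<Rightarrow> real vec set" where
  "mat_range A = {A *\<^sub>v x | x. x \<in> carrier_vec (dim_col A)}"

definition vec_norm2 :: "real vec \<Rightarrow> real" where
  "vec_norm2 v = sqrt (v \<bullet> v)"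

text \<open>
  The columns of the \<open>n \<times> d\<close> matrix \<open>Z\<close> form an orthonormal basis of the null space of the
  \<open>n \<times> n\<close> matrix \<open>H\<close>; \<open>d = 0\<close> is the case of a nonsingular \<open>H\<close>.  Since \<open>kernel.basis\<close> speaks about
  the set of columns, repeated columns are excluded by orthonormality.
\<close>
definition orthonormal_null_basis :: "nat \<Rightarrow> nat \<Rightarrow> real mat \<Rightarrow> real mat \<Rightarrow> bool" where
  "orthonormal_null_basis n d H Z \<longleftrightarrow>
     Z \<in> carrier_mat n d \<and>
     (\<forall>i<d. \<forall>j<d. col Z i \<bullet> col Z j = (if i = j then 1 else 0)) \<and>
     kernel.basis n H (set (cols Z))"

definition krylov :: "nat \<Rightarrow> real mat \<Rightarrow> real vec \<Rightarrow> nat \<Rightarrow> real vec set" where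
  "krylov n H c k =
     LinearCombinations.module.span class_ring (module_vec TYPE(real) n) ((\<lambda>j. (H ^\<^sub>m j) *\<^sub>v c) ` {..<k})"

definition krylov_index :: "nat \<Rightarrow> real mat \<Rightarrow> real vec \<Rightarrow> nat" where
  "krylov_index n H c = (LEAST k. 0 < k \<and> krylov n H c (Suc k) = krylov n H c k)"

definition lanczos_ratio :: "real mat \<Rightarrow> real vec \<Rightarrow> real vec \<Rightarrow> real" where
  "lanczos_ratio H u v = (u \<bullet> (H *\<^sub>v v)) / (u \<bullet> u)"

fun lanczos_q :: "real mat \<Rightarrow> real vec \<Rightarrow> (nat \<Rightarrow> real) \<Rightarrow> nat \<Rightarrow> real vec" where
  "lanczos_q H c \<theta> 0 = c"
| "lanczos_q H c \<theta> (Suc 0) =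
     \<theta> 0 \<cdot>\<^sub>v (- (H *\<^sub>v lanczos_q H c \<theta> 0)
       + lanczos_ratio H (lanczos_q H c \<theta> 0) (lanczos_q H c \<theta> 0) \<cdot>\<^sub>v lanczos_q H c \<theta> 0)"
| "lanczos_q H c \<theta> (Suc (Suc k)) =
     \<theta> (Suc k) \<cdot>\<^sub>v (- (H *\<^sub>v lanczos_q H c \<theta> (Suc k))
       + lanczos_ratio H (lanczos_q H c \<theta> (Suc k)) (lanczos_q H c \<theta> (Suc k))
           \<cdot>\<^sub>v lanczos_q H c \<theta> (Suc k)
       + lanczos_ratio H (lanczos_q H c \<theta> k) (lanczos_q H c \<theta> (Suc k))
           \<cdot>\<^sub>v lanczos_q H c \<theta> k)"

definition lanczos_alpha :: "real mat \<Rightarrow> real vec \<Rightarrow> (nat \<Rightarrow> real) \<Rightarrow> nat \<Rightarrow> real" where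
  "lanczos_alpha H c \<theta> k = lanczos_ratio H (lanczos_q H c \<theta> k) (lanczos_q H c \<theta> k)"

text \<open>The index is that of the usual notation: \<open>lanczos_beta H c \<theta> k\<close> relates \<open>q\<^sub>k\<close> and \<open>q\<^sub>k\<^sub>+\<^sub>1\<close>.\<close>
definition lanczos_beta :: "real mat \<Rightarrow> real vec \<Rightarrow> (nat \<Rightarrow> real) \<Rightarrow> nat \<Rightarrow> real" where
  "lanczos_beta H c \<theta> k = lanczos_ratio H (lanczos_q H c \<theta> k) (lanczos_q H c \<theta> (Suc k))"

fun lanczos_y :: "nat \<Rightarrow> real mat \<Rightarrow> real vec \<Rightarrow> (nat \<Rightarrow> real) \<Rightarrow> nat \<Rightarrow> real vec" where
  "lanczos_y n H c \<theta> 0 = 0\<^sub>v n"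
| "lanczos_y n H c \<theta> (Suc 0) =
     \<theta> 0 \<cdot>\<^sub>v (- lanczos_q H c \<theta> 0 + lanczos_alpha H c \<theta> 0 \<cdot>\<^sub>v lanczos_y n H c \<theta> 0)"
| "lanczos_y n H c \<theta> (Suc (Suc k)) =
     \<theta> (Suc k) \<cdot>\<^sub>v (- lanczos_q H c \<theta> (Suc k)
       + lanczos_alpha H c \<theta> (Suc k) \<cdot>\<^sub>v lanczos_y n H c \<theta> (Suc k)
       + lanczos_beta H c \<theta> k \<cdot>\<^sub>v lanczos_y n H c \<theta> k)"

fun lanczos_delta :: "real mat \<Rightarrow> real vec \<Rightarrow> (nat \<Rightarrow> real) \<Rightarrow> nat \<Rightarrow> real" where
  "lanczos_delta H c \<theta> 0 = 1"
| "lanczos_delta H c \<theta> (Suc 0) = \<theta> 0 * (lanczos_alpha H c \<theta> 0 * lanczos_delta H c \<theta> 0)"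
| "lanczos_delta H c \<theta> (Suc (Suc k)) =
     \<theta> (Suc k) * (lanczos_alpha H c \<theta> (Suc k) * lanczos_delta H c \<theta> (Suc k)
       + lanczos_beta H c \<theta> k * lanczos_delta H c \<theta> k)"

text \<open>
  \<open>krylov_coeff n H c k v j\<close> is the coefficient of \<open>H\<^bsup>j-1\<^esup>c\<close> in the expansion of \<open>v\<close> in terms of
  \<open>c, Hc, \<dots>, H\<^bsup>k-1\<^esup>c\<close>.  Coefficients outside \<open>{1..k}\<close> are set to \<open>0\<close> only to make the coefficient
  function unique.
\<close>
definition krylov_coeff :: "nat \<Rightarrow> real mat \<Rightarrow> real vec \<Rightarrow> nat \<Rightarrow> real vec \<Rightarrow> nat \<Rightarrow> real" where
  "krylov_coeff n H c k v =
     (THE a. (\<forall>j. j \<notin> {1..k} \<longrightarrow> a j = 0) \<and>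
        v = finsum_vec TYPE(real) n (\<lambda>j. a j \<cdot>\<^sub>v ((H ^\<^sub>m (j - 1)) *\<^sub>v c)) {1..k})"

definition lanczos_coeff ::
    "nat \<Rightarrow> real mat \<Rightarrow> real vec \<Rightarrow> (nat \<Rightarrow> real) \<Rightarrow> nat \<Rightarrow> nat \<Rightarrow> real" where
  "lanczos_coeff n H c \<theta> k j = krylov_coeff n H c k (lanczos_y n H c \<theta> k) j"

end

theory Submission
  imports Defs "HOL-Computational_Algebra.Polynomial"
begin

text \<open>
  The proof reads every vector of the Krylov spaces as \<open>p(H)c\<close> for a real polynomial \<open>p\<close>.  The
  recursions then say that \<open>y\<^sub>k = s\<^sub>k(H)c\<close> and \<open>q\<^sub>k = p\<^sub>k(H)c\<close> with \<open>p\<^sub>k = \<delta>\<^sub>k + X s\<^sub>k\<close>, where \<open>p\<^sub>k\<close> has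
  degree exactly \<open>k\<close> because the \<open>\<theta>\<^sub>k\<close> are nonzero (\<open>lanczos_qy_as_poly\<close>, \<open>lead_coeff_lanczos_y_poly\<close>).
  The number \<open>r\<close> is the degree of the minimal polynomial of \<open>H\<close> with respect to \<open>c\<close>: no nonzero
  polynomial of smaller degree annihilates \<open>c\<close> (\<open>P_eq_0_imp_eq_0\<close>).  The choice of \<open>\<alpha>\<^sub>k\<close> and \<open>\<beta>\<^sub>k\<close> makes
  the \<open>q\<^sub>k\<close> mutually orthogonal, so \<open>q\<^sub>r\<close> is orthogonal to the \<open>r\<close>-th Krylov space; as that space no longer
  grows, it also contains \<open>q\<^sub>r\<close>, and \<open>q\<^sub>r = 0\<close> (\<open>lanczos_q_krylov_index\<close>).  Thus \<open>p\<^sub>r\<close> is, up to a factor,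
  the minimal polynomial, and \<open>\<delta>\<^sub>r\<close> and \<open>\<delta>\<^sub>r\<^sup>1\<close> are its coefficients at \<open>1\<close> and \<open>X\<close>.

  If \<open>\<delta>\<^sub>r \<noteq> 0\<close>, the equation \<open>H y\<^sub>r + \<delta>\<^sub>r c = 0\<close> is solved for \<open>c\<close>, and everything built from \<open>c\<close> by powers
  of \<open>H\<close> lies in the range of \<open>H\<close>, which is orthogonal to the null space.

  If \<open>\<delta>\<^sub>r = 0\<close>, then \<open>y\<^sub>r\<close> lies in the null space, and it is nonzero since \<open>s\<^sub>r\<close> has degree \<open>r - 1\<close>.  Write
  \<open>s\<^sub>r = \<delta>\<^sub>r\<^sup>1 + X t\<close>.  A symmetric \<open>H\<close> satisfies \<open>H\<^sup>2 v = 0 \<Longrightarrow> H v = 0\<close>, so \<open>0\<close> is at most a simple root of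
  the minimal polynomial; this forces \<open>\<delta>\<^sub>r\<^sup>1 \<noteq> 0\<close>.  The projection \<open>Z Z\<^sup>T\<close> onto the null space fixes \<open>y\<^sub>r\<close> and
  kills \<open>H t(H)c\<close>, which gives \<open>y\<^sub>r = \<delta>\<^sub>r\<^sup>1 Z Z\<^sup>T c\<close>.  With \<open>y\<^sub>r\<^sup>1 = t(H)c\<close>, the equation \<open>H y\<^sub>r = 0\<close> is, after
  division by \<open>\<delta>\<^sub>r\<^sup>1\<close>, the normal equation of the least squares problem.
\<close>

section \<open>Symmetric matrices and their null spaces\<close>

lemma scalar_prod_self_nonneg: "0 \<le> v \<bullet> v" for v :: "real vec"
  by (simp add: scalar_prod_def sum_nonneg)

lemma mult_mat_zero_vec: "A \<in> carrier_mat m n \<Longrightarrow> A *\<^sub>v 0\<^sub>v n = 0\<^sub>v m"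
  for A :: "'a :: semiring_0 mat"
  by (intro eq_vecI) auto

lemma scalar_prod_self_eq_0_real:
  fixes v :: "real vec"
  assumes "v \<in> carrier_vec n" "v \<bullet> v = 0"
  shows "v = 0\<^sub>v n"
proof -
  have "(\<Sum>i\<in>{0..<n}. v $ i * v $ i) = 0"
    using assms by (simp add: scalar_prod_def carrier_vecD)
  then have "\<forall>i\<in>{0..<n}. v $ i * v $ i = 0"
    by (subst (asm) sum_nonneg_eq_0_iff) auto
  then show ?thesis
    using assms by (intro eq_vecI) auto
qed

lemma scalar_prod_symmetric_mat:
  fixes H :: "real mat"
  assumes "H \<in> carrier_mat n n" "transpose_mat H = H" "u \<in> carrier_vec n" "v \<in> carrier_vec n"
  shows "(H *\<^sub>v u) \<bullet> v = u \<bullet> (H *\<^sub>v v)"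
  by (metis assms transpose_vec_mult_scalar comm_scalar_prod mult_mat_vec_carrier)

text \<open>
  If \<open>H (H v) = 0\<close>, then \<open>|H v|\<^sup>2 = v \<bullet> H (H v) = 0\<close>.  This is where the diagonalizability of a symmetric
  matrix enters: \<open>0\<close> is a simple root of the minimal polynomial, if it is a root.
\<close>
lemma symmetric_mat_square_kernel:
  fixes H :: "real mat"
  assumes H: "H \<in> carrier_mat n n" "transpose_mat H = H" and v: "v \<in> carrier_vec n"
    and HHv: "H *\<^sub>v (H *\<^sub>v v) = 0\<^sub>v n"
  shows "H *\<^sub>v v = 0\<^sub>v n"
proof (rule scalar_prod_self_eq_0_real)
  show "H *\<^sub>v v \<in> carrier_vec n"
    using H v by simp
  then show "(H *\<^sub>v v) \<bullet> (H *\<^sub>v v) = 0"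
    using scalar_prod_symmetric_mat[OF H v, of "H *\<^sub>v v"] HHv v by simp
qed

text \<open>
  The fixed vectors of \<open>Z Z\<^sup>T\<close> form a subspace, and by orthonormality it contains the columns of \<open>Z\<close>;
  so it contains the null space that they span.
\<close>
lemma orthonormal_null_basis_projection:
  assumes H: "H \<in> carrier_mat n n" and Z: "orthonormal_null_basis n d H Z"
    and v: "v \<in> carrier_vec n" "H *\<^sub>v v = 0\<^sub>v n"
  shows "(Z * transpose_mat Z) *\<^sub>v v = v"
proof -
  interpret K: kernel n n H
    by unfold_locales (rule H)
  have Zc: "Z \<in> carrier_mat n d"
    and on: "\<And>i j. i < d \<Longrightarrow> j < d \<Longrightarrow> col Z i \<bullet> col Z j = (if i = j then 1 else 0)"
    and bas: "K.basis (set (cols Z))"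
    using Z by (auto simp: orthonormal_null_basis_def)
  let ?N = "{w \<in> carrier_vec n. (Z * transpose_mat Z) *\<^sub>v w = w}"
  have ZT: "Z * transpose_mat Z \<in> carrier_mat n n"
    using Zc by auto
  have sub: "submodule class_ring ?N K.NC.V"
    by (rule submodule.intro)
      (use ZT vec_module in \<open>auto simp: mult_add_distrib_mat_vec[OF ZT] mult_mat_vec[OF ZT]
        mult_mat_zero_vec[OF ZT]
        module_vec_simps class_ring_simps\<close>)
  have ZTZ: "transpose_mat Z * Z = 1\<^sub>m d"
    using Zc on by (intro eq_matI) auto
  have "set (cols Z) \<subseteq> ?N"
  proof
    fix w assume "w \<in> set (cols Z)"
    then obtain j where j: "j < d" "w = col Z j"
      using Zc by (auto simp: cols_def)
    have w: "w = Z *\<^sub>v unit_vec d j"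
      using Zc j by (intro eq_vecI) (auto simp: scalar_prod_right_unit)
    have "transpose_mat Z *\<^sub>v w = unit_vec d j"
      unfolding w using Zc ZTZ
      by (subst assoc_mult_mat_vec[symmetric, of _ d n _ d]) auto
    then show "w \<in> ?N"
      using Zc w by (auto simp: assoc_mult_mat_vec[of _ n d _ n])
  qed
  then have "K.NC.span (set (cols Z)) \<subseteq> ?N"
    by (rule K.NC.span_is_subset[OF _ sub])
  moreover have "v \<in> K.span (set (cols Z))"
    using bas mat_kernelI[OF H v] by (auto simp: K.Ker.basis_def)
  moreover have "set (cols Z) \<subseteq> mat_kernel H"
    using bas by (auto simp: K.Ker.basis_def)
  ultimately show ?thesis
    using K.span_same by auto
qed

text \<open>
  The range of a symmetric matrix is orthogonal to its null space.
\<close>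
lemma orthonormal_null_basis_transpose_mult:
  assumes H: "H \<in> carrier_mat n n" "transpose_mat H = H" and Z: "orthonormal_null_basis n d H Z"
    and x: "x \<in> carrier_vec n"
  shows "transpose_mat Z *\<^sub>v (H *\<^sub>v x) = 0\<^sub>v d"
proof -
  interpret K: kernel n n H
    by unfold_locales (rule H)
  have Zc: "Z \<in> carrier_mat n d" and bas: "K.basis (set (cols Z))"
    using Z by (auto simp: orthonormal_null_basis_def)
  have "col Z i \<bullet> (H *\<^sub>v x) = 0" if i: "i < d" for i
  proof -
    have "col Z i \<in> mat_kernel H"
      using bas i Zc by (auto simp: K.Ker.basis_def cols_def)
    then have "col Z i \<in> carrier_vec n" "H *\<^sub>v col Z i = 0\<^sub>v n"
      using mat_kernelD[OF H(1)] by auto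
    then show ?thesis
      using scalar_prod_symmetric_mat[OF H _ x, of "col Z i"] x by simp
  qed
  then show ?thesis
    using Zc H x by (intro eq_vecI) auto
qed

text \<open>
  Moving from \<open>x\<close> to \<open>z\<close> changes the residual \<open>H x + c\<close> by \<open>H (z - x)\<close>.  The residual lies in the
  null space of the symmetric \<open>H\<close>, hence is orthogonal to this change, and by Pythagoras the norm does
  not decrease.
\<close>
lemma normal_equations_imp_least_squares:
  fixes H :: "real mat"
  assumes H: "H \<in> carrier_mat n n" "transpose_mat H = H" and c: "c \<in> carrier_vec n"
    and x: "x \<in> carrier_vec n" and ne: "H *\<^sub>v (H *\<^sub>v x + c) = 0\<^sub>v n"
  shows "is_arg_min (\<lambda>x. (vec_norm2 (H *\<^sub>v x + c))\<^sup>2) (\<lambda>x. x \<in> carrier_vec n) x"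
proof -
  let ?g = "H *\<^sub>v x + c"
  have norm2: "(vec_norm2 v)\<^sup>2 = v \<bullet> v" for v
    by (simp add: vec_norm2_def scalar_prod_self_nonneg)
  have "?g \<bullet> ?g \<le> (H *\<^sub>v z + c) \<bullet> (H *\<^sub>v z + c)" if z: "z \<in> carrier_vec n" for z
  proof -
    let ?e = "H *\<^sub>v (z - x)"
    have g: "?g \<in> carrier_vec n" and e: "?e \<in> carrier_vec n"
      using H c x z by auto
    have "H *\<^sub>v z + c = ?g + ?e"
      using H c x z by (intro eq_vecI) (auto simp: scalar_prod_minus_distrib[of _ n])
    then have "(H *\<^sub>v z + c) \<bullet> (H *\<^sub>v z + c) = ?g \<bullet> ?g + 2 * (?e \<bullet> ?g) + ?e \<bullet> ?e"
      using g e comm_scalar_prod[OF g e]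
      by (simp add: add_scalar_prod_distrib[of _ n] scalar_prod_add_distrib[of _ n])
    moreover have "?e \<bullet> ?g = 0"
      using scalar_prod_symmetric_mat[OF H _ g, of "z - x"] ne x z by simp
    ultimately show ?thesis
      using scalar_prod_self_nonneg[of ?e] by simp
  qed
  then show ?thesis
    using x by (auto simp: is_arg_min_linorder norm2)
qed

section \<open>Krylov spaces as images of polynomials\<close>

text \<open>
  The vector \<open>p(H)c\<close>, evaluated by the Horner scheme.  This form makes multiplication by \<open>H\<close> the
  operation \<open>pCons 0\<close> on polynomials.
\<close>
definition krylov_comb :: "nat \<Rightarrow> real mat \<Rightarrow> real vec \<Rightarrow> real poly \<Rightarrow> real vec" where
  "krylov_comb n H c p = fold_coeffs (\<lambda>a v. a \<cdot>\<^sub>v c + H *\<^sub>v v) p (0\<^sub>v n)"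

locale symmetric_krylov =
  fixes n :: nat and H :: "real mat" and c :: "real vec"
  assumes H: "H \<in> carrier_mat n n"
    and H_sym: "transpose_mat H = H"
    and c: "c \<in> carrier_vec n"
begin

abbreviation P where "P \<equiv> krylov_comb n H c"

lemma P_0 [simp]: "P 0 = 0\<^sub>v n"
  by (simp add: krylov_comb_def)

lemma P_pCons [simp]: "P (pCons a p) = a \<cdot>\<^sub>v c + H *\<^sub>v P p"
  using H c by (cases "a = 0 \<and> p = 0") (auto simp: krylov_comb_def)

lemma zero_smult_c [simp]: "0 \<cdot>\<^sub>v c = 0\<^sub>v n"
  using c by auto

lemma pow_mat_c_carrier [simp]: "(H ^\<^sub>m k) *\<^sub>v c \<in> carrier_vec n"
  using H c by (auto intro!: mult_mat_vec_carrier[of _ n n])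

lemma P_carrier [simp]: "P p \<in> carrier_vec n"
  using H c by (induction p) auto

lemma dim_P [simp]: "dim_vec (P p) = n"
  using carrier_vecD[OF P_carrier] .

lemma P_add: "P (p + q) = P p + P q"
proof (induction p q rule: poly_induct2)
  case (pCons a p b q)
  then show ?case
    using H c mult_add_distrib_mat_vec[OF H P_carrier P_carrier, of p q]
    by (intro eq_vecI) (auto simp: algebra_simps)
qed simp

lemma P_smult: "P (Polynomial.smult a p) = a \<cdot>\<^sub>v P p"
proof (induction p)
  case (pCons b p)
  then show ?case
    using H c mult_mat_vec[OF H P_carrier, of a p]
    by (intro eq_vecI) (auto simp: algebra_simps)
qed auto

lemma P_uminus: "P (- p) = - P p"
  using P_smult[of "-1" p] by auto

lemma P_diff: "P (p - q) = P p - P q"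
  using P_add[of p "- q"] P_uminus[of q] by auto

lemma P_monom: "P (monom a k) = a \<cdot>\<^sub>v ((H ^\<^sub>m k) *\<^sub>v c)"
proof -
  have "P (monom 1 k) = (H ^\<^sub>m k) *\<^sub>v c"
  proof (induction k)
    case (Suc k)
    have comm: "H * H ^\<^sub>m k = H ^\<^sub>m k * H"
    proof (induction k)
      case (Suc k)
      then show ?case
        using H by (simp add: assoc_mult_mat[of _ n n _ n _ n, symmetric])
    qed (use H in simp)
    have "P (monom 1 (Suc k)) = H *\<^sub>v ((H ^\<^sub>m k) *\<^sub>v c)"
      using Suc H c by (simp add: monom_Suc)
    also have "\<dots> = (H ^\<^sub>m Suc k) *\<^sub>v c"
      using H c comm by (simp add: assoc_mult_mat_vec[of _ n n _ n, symmetric])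
    finally show ?case .
  qed (use H c in \<open>auto simp: monom_0\<close>)
  then show ?thesis
    using P_smult[of a "monom 1 k"] by (simp add: smult_monom)
qed

text \<open>
  Polynomials of degree less than \<open>k\<close> are described by their vanishing coefficients, which covers the
  zero space at \<open>k = 0\<close> without a special case.
\<close>
lemma krylov_eq_image: "krylov n H c k = P ` {p. \<forall>i\<ge>k. coeff p i = 0}" (is "_ = P ` ?D k")
proof -
  interpret V: vec_space "TYPE(real)" n .
  let ?S = "\<lambda>k. (\<lambda>j. (H ^\<^sub>m j) *\<^sub>v c) ` {..<k}"
  have S: "?S k \<subseteq> carrier_vec n" for k
    using H c by auto
  have gen: "(H ^\<^sub>m j) *\<^sub>v c = P (monom 1 j)" for j
    by (simp add: P_monom)
  have "submodule class_ring (P ` ?D k) V.V"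
  proof (rule submodule.intro)
    show "module class_ring V.V"
      by (rule vec_module)
    show "P ` ?D k \<subseteq> carrier V.V"
      by (auto simp: module_vec_simps)
    show "\<zero>\<^bsub>V.V\<^esub> \<in> P ` ?D k"
      by (auto simp: module_vec_simps intro!: image_eqI[of _ _ 0])
    show "v \<oplus>\<^bsub>V.V\<^esub> w \<in> P ` ?D k" if "v \<in> P ` ?D k" "w \<in> P ` ?D k" for v w
      using that by (auto simp: module_vec_simps P_add[symmetric])
    show "a \<odot>\<^bsub>V.V\<^esub> v \<in> P ` ?D k" if "a \<in> carrier class_ring" "v \<in> P ` ?D k" for a v
      using that by (auto simp: module_vec_simps P_smult[symmetric])
  qed
  moreover have "?S k \<subseteq> P ` ?D k"
    by (auto simp: gen)
  ultimately have "krylov n H c k \<subseteq> P ` ?D k"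
    unfolding krylov_def by (intro V.span_is_subset)
  moreover have "P p \<in> krylov n H c k" if "p \<in> ?D k" for p
    using that
  proof (induction k arbitrary: p)
    case 0
    then have "p = 0"
      by (auto intro: poly_eqI)
    then show ?case
      unfolding krylov_def using V.span_zero by simp
  next
    case (Suc k)
    let ?m = "monom (coeff p k) k"
    have "coeff (p - ?m) i = 0" if "k \<le> i" for i
      using that Suc.prems by (cases "i = k") auto
    then have "p - ?m \<in> ?D k"
      by blast
    then have "P (p - ?m) \<in> krylov n H c k"
      by (rule Suc.IH)
    moreover have "krylov n H c k \<subseteq> krylov n H c (Suc k)"
      unfolding krylov_def by (intro V.span_is_monotone image_mono) auto
    moreover have "(H ^\<^sub>m k) *\<^sub>v c \<in> krylov n H c (Suc k)"
      unfolding krylov_def using V.in_own_span[OF S, of "Suc k"] by auto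
    then have "P ?m \<in> krylov n H c (Suc k)"
      unfolding krylov_def P_monom
      using submodule.smult_closed[OF V.span_is_submodule[OF S], of "coeff p k"]
      by (auto simp: module_vec_simps)
    ultimately have "P (p - ?m) + P ?m \<in> krylov n H c (Suc k)"
      unfolding krylov_def using V.span_add1[OF S] by blast
    then show ?case
      by (simp add: P_add[symmetric])
  qed
  ultimately show ?thesis
    by auto
qed

lemma in_krylovI: "(\<And>i. k \<le> i \<Longrightarrow> coeff p i = 0) \<Longrightarrow> P p \<in> krylov n H c k"
  by (auto simp: krylov_eq_image)

lemma krylov_Suc_eqI:
  assumes "(H ^\<^sub>m k) *\<^sub>v c \<in> krylov n H c k"
  shows "krylov n H c (Suc k) = krylov n H c k"
proof
  show "krylov n H c k \<subseteq> krylov n H c (Suc k)"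
    by (auto simp: krylov_eq_image)
  obtain g where g: "P (monom 1 k) = P g" "\<forall>i\<ge>k. coeff g i = 0"
    using assms by (auto simp: krylov_eq_image P_monom)
  show "krylov n H c (Suc k) \<subseteq> krylov n H c k"
  proof
    fix v assume "v \<in> krylov n H c (Suc k)"
    then obtain p where p: "v = P p" "\<forall>i\<ge>Suc k. coeff p i = 0"
      by (auto simp: krylov_eq_image)
    let ?p = "p + Polynomial.smult (coeff p k) (g - monom 1 k)"
    have "P ?p = v"
      using p(1) g(1) by (auto simp: P_add P_smult P_diff)
    moreover have "coeff ?p i = 0" if "k \<le> i" for i
      using that p(2) g(2) by (cases "i = k") auto
    ultimately show "v \<in> krylov n H c k"
      using in_krylovI by metis
  qed
qed

text \<open>
  If no Krylov space with positive index were stationary, each \<open>H\<^sup>k c\<close> would lie outside the span of its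
  predecessors, and \<open>c, H c, \<dots>, H\<^sup>n c\<close> would be \<open>n + 1\<close> linearly independent vectors in dimension \<open>n\<close>.
\<close>
lemma ex_krylov_stationary:
  assumes c_nz: "c \<noteq> 0\<^sub>v n"
  shows "\<exists>k>0. krylov n H c (Suc k) = krylov n H c k"
proof (rule ccontr)
  interpret V: vec_space "TYPE(real)" n .
  let ?v = "\<lambda>j. (H ^\<^sub>m j) *\<^sub>v c"
  assume "\<not> ?thesis"
  then have new: "?v k \<notin> krylov n H c k" if "k > 0" for k
    using krylov_Suc_eqI[of k] that by blast
  have "krylov n H c 0 = {0\<^sub>v n}"
    using V.span_empty by (simp add: krylov_def)
  then have new0: "?v 0 \<notin> krylov n H c 0"
    using c_nz c H by simp
  have S: "?v ` {..<k} \<subseteq> carrier_vec n" for k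
    using H c by auto
  have "card (?v ` {..<k}) = k \<and> V.lin_indpt (?v ` {..<k})" for k
  proof (induction k)
    case 0
    then show ?case
      by (simp add: V.lin_dep_def)
  next
    case (Suc k)
    have notin: "?v k \<notin> V.span (?v ` {..<k})"
      using new[of k] new0 unfolding krylov_def by (cases k) auto
    moreover have fresh: "?v k \<notin> ?v ` {..<k}"
      using notin V.in_own_span[OF S[of k]] by blast
    ultimately have "V.lin_indpt (?v ` {..<k} \<union> {?v k})"
      using V.lin_dep_iff_in_span[of "?v ` {..<k}" "?v k"] Suc S H c by auto
    then show ?case
      using Suc fresh by (simp add: lessThan_Suc)
  qed
  then have "card (?v ` {..<Suc n}) = Suc n" "V.lin_indpt (?v ` {..<Suc n})"
    by blast+
  then show False
    using V.li_le_dim(2)[OF V.fin_dim, of "?v ` {..<Suc n}"] S[of "Suc n"] V.dim_is_n by simp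
qed

lemma krylov_index_pos: "c \<noteq> 0\<^sub>v n \<Longrightarrow> 0 < krylov_index n H c"
  and krylov_index_stationary: "c \<noteq> 0\<^sub>v n \<Longrightarrow>
    krylov n H c (Suc (krylov_index n H c)) = krylov n H c (krylov_index n H c)"
  using LeastI_ex[OF ex_krylov_stationary] by (auto simp: krylov_index_def)

text \<open>
  Linear independence of \<open>c, H c, \<dots>, H\<^bsup>r-1\<^esup>c\<close> in polynomial form.  An annihilating polynomial of degree
  \<open>k < r\<close> would express \<open>H\<^sup>k c\<close> by lower powers, so the Krylov spaces would be stationary at \<open>k\<close> already.
\<close>
lemma P_eq_0_imp_eq_0:
  assumes c_nz: "c \<noteq> 0\<^sub>v n" and p0: "P p = 0\<^sub>v n"
    and small: "\<And>i. krylov_index n H c \<le> i \<Longrightarrow> coeff p i = 0"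
  shows "p = 0"
proof (rule ccontr)
  assume p: "p \<noteq> 0"
  define k where "k = degree p"
  have a: "coeff p k \<noteq> 0"
    using p by (simp add: k_def)
  then have k: "k < krylov_index n H c"
    using small[of k] by force
  let ?g = "monom 1 k - Polynomial.smult (1 / coeff p k) p"
  have "coeff ?g i = 0" if "k \<le> i" for i
    using that a coeff_eq_0[of p i] by (cases "i = k") (auto simp: k_def)
  then have "P ?g \<in> krylov n H c k"
    by (rule in_krylovI)
  moreover have Pg: "P ?g = (H ^\<^sub>m k) *\<^sub>v c"
    using H c by (auto simp: P_diff P_smult P_monom p0)
  ultimately have in_k: "(H ^\<^sub>m k) *\<^sub>v c \<in> krylov n H c k"
    by simp
  \<comment> \<open>The index \<open>r\<close> is minimal among the positive ones only, so \<open>k = 0\<close> rests on \<open>c \<noteq> 0\<close>.\<close>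
  show False
  proof (cases "k = 0")
    case True
    interpret V: vec_space "TYPE(real)" n .
    show ?thesis
      using in_k True c_nz c H V.span_empty by (simp add: krylov_def)
  next
    case False
    then show ?thesis
      using krylov_Suc_eqI[OF in_k] k not_less_Least[of k]
      by (auto simp: krylov_index_def)
  qed
qed

lemma P_as_finsum:
  assumes "\<And>i. k \<le> i \<Longrightarrow> coeff p i = 0"
  shows "P p = finsum_vec TYPE(real) n (\<lambda>j. coeff p (j - 1) \<cdot>\<^sub>v ((H ^\<^sub>m (j - 1)) *\<^sub>v c)) {1..k}"
  using assms
proof (induction k arbitrary: p)
  case 0
  then have "p = 0"
    by (auto intro: poly_eqI)
  then show ?case
    by (simp add: finsum_vec_empty)
next
  case (Suc k)
  let ?m = "monom (coeff p k) k"
  let ?f = "\<lambda>p j. coeff p (j - 1) \<cdot>\<^sub>v ((H ^\<^sub>m (j - 1)) *\<^sub>v c)"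
  interpret V: vec_space "TYPE(real)" n .
  have f: "?f p \<in> A \<rightarrow> carrier_vec n" for p A
    using H c by auto
  have "coeff (p - ?m) i = 0" if "k \<le> i" for i
    using that Suc.prems[of i] by (cases "i = k") auto
  then have "P (p - ?m) = finsum_vec TYPE(real) n (?f (p - ?m)) {1..k}"
    by (rule Suc.IH)
  also have "\<dots> = finsum_vec TYPE(real) n (?f p) {1..k}"
    unfolding V.finsum_vec by (rule V.finsum_cong2) (use H c in auto)
  finally have "P p = P ?m + finsum_vec TYPE(real) n (?f p) {1..k}"
    using P_add[of ?m "p - ?m"] by simp
  also have "\<dots> = finsum_vec TYPE(real) n (?f p) (insert (Suc k) {1..k})"
    using f[of p "{1..k}"] H c by (subst finsum_vec_insert) (auto simp: P_monom)
  also have "insert (Suc k) {1..k} = {1..Suc k}"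
    by auto
  finally show ?case .
qed

text \<open>
  By linear independence, the expansion of \<open>p(H)c\<close> in the Krylov basis is given by the coefficients of
  \<open>p\<close>; the indices are shifted by one because coefficients with respect to the basis are counted from \<open>1\<close>.
\<close>
lemma krylov_coeff_P:
  assumes c_nz: "c \<noteq> 0\<^sub>v n"
    and p: "\<And>i. krylov_index n H c \<le> i \<Longrightarrow> coeff p i = 0"
    and j: "j \<in> {1..krylov_index n H c}"
  shows "krylov_coeff n H c (krylov_index n H c) (P p) j = coeff p (j - 1)"
proof -
  let ?r = "krylov_index n H c"
  let ?a = "\<lambda>j. if j \<in> {1..?r} then coeff p (j - 1) else 0"
  interpret V: vec_space "TYPE(real)" n .
  have "krylov_coeff n H c ?r (P p) = ?a"
    unfolding krylov_coeff_def
  proof (rule the_equality, intro conjI allI impI)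
    show "P p = finsum_vec TYPE(real) n (\<lambda>j. ?a j \<cdot>\<^sub>v ((H ^\<^sub>m (j - 1)) *\<^sub>v c)) {1..?r}"
      unfolding V.finsum_vec
      by (rule trans[OF P_as_finsum[OF p, unfolded V.finsum_vec] V.finsum_cong2]) auto
  next
    fix b
    assume b: "(\<forall>j. j \<notin> {1..?r} \<longrightarrow> b j = 0) \<and>
      P p = finsum_vec TYPE(real) n (\<lambda>j. b j \<cdot>\<^sub>v ((H ^\<^sub>m (j - 1)) *\<^sub>v c)) {1..?r}"
    define q where "q = (\<Sum>i<?r. monom (b (Suc i)) i)"
    have cq: "coeff q i = (if i < ?r then b (Suc i) else 0)" for i
      by (simp add: q_def coeff_sum sum.delta)
    have "P q = finsum_vec TYPE(real) n (\<lambda>j. coeff q (j - 1) \<cdot>\<^sub>v ((H ^\<^sub>m (j - 1)) *\<^sub>v c)) {1..?r}"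
      by (rule P_as_finsum) (simp add: cq)
    also have "\<dots> = finsum_vec TYPE(real) n (\<lambda>j. b j \<cdot>\<^sub>v ((H ^\<^sub>m (j - 1)) *\<^sub>v c)) {1..?r}"
      unfolding V.finsum_vec by (rule V.finsum_cong2) (use H c in \<open>auto simp: cq\<close>)
    finally have "P (p - q) = 0\<^sub>v n"
      using b by (simp add: P_diff)
    then have "p - q = 0"
      by (rule P_eq_0_imp_eq_0[OF c_nz]) (simp add: p cq)
    then have cp: "coeff p i = (if i < ?r then b (Suc i) else 0)" for i
      using cq by simp
    show "b = ?a"
    proof
      show "b j = ?a j" for j
        using cp[of "j - 1"] b by (cases "j \<in> {1..?r}") auto
    qed
  qed auto
  then show ?thesis
    using j by simp
qed

end

section \<open>The polynomials of the Lanczos vectors\<close>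

text \<open>
  The polynomial \<open>s\<^sub>k\<close> with \<open>y\<^sub>k = s\<^sub>k(H)c\<close>.  The recursion is that of \<open>y\<^sub>k\<close>, with \<open>q\<^sub>k\<close> replaced by its own
  polynomial \<open>\<delta>\<^sub>k + X s\<^sub>k\<close>, so that \<open>q\<^sub>k = H y\<^sub>k + \<delta>\<^sub>k c\<close> is built in.
\<close>
fun lanczos_y_poly :: "real mat \<Rightarrow> real vec \<Rightarrow> (nat \<Rightarrow> real) \<Rightarrow> nat \<Rightarrow> real poly" where
  "lanczos_y_poly H c \<theta> 0 = 0"
| "lanczos_y_poly H c \<theta> (Suc 0) =
     Polynomial.smult (\<theta> 0) (- pCons (lanczos_delta H c \<theta> 0) (lanczos_y_poly H c \<theta> 0)
       + Polynomial.smult (lanczos_alpha H c \<theta> 0) (lanczos_y_poly H c \<theta> 0))"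
| "lanczos_y_poly H c \<theta> (Suc (Suc k)) =
     Polynomial.smult (\<theta> (Suc k)) (- pCons (lanczos_delta H c \<theta> (Suc k)) (lanczos_y_poly H c \<theta> (Suc k))
       + Polynomial.smult (lanczos_alpha H c \<theta> (Suc k)) (lanczos_y_poly H c \<theta> (Suc k))
       + Polynomial.smult (lanczos_beta H c \<theta> k) (lanczos_y_poly H c \<theta> k))"

text \<open>
  \<open>s\<^sub>k\<close> has degree less than \<open>k\<close>, that is, \<open>y\<^sub>k\<close> lies in the \<open>k\<close>-th Krylov space.
\<close>
lemma coeff_lanczos_y_poly_eq_0: "k \<le> j \<Longrightarrow> coeff (lanczos_y_poly H c \<theta> k) j = 0"
proof (induction k arbitrary: j rule: less_induct)
  case (less k)
  show ?case
  proof (cases "(H, c, \<theta>, k)" rule: lanczos_y_poly.cases)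
    case (3 _ _ _ l)
    then show ?thesis
      using less.IH[of "Suc l"] less.IH[of l] less.prems by (cases j) auto
  qed (use less.prems in \<open>auto simp: coeff_pCons split: nat.splits\<close>)
qed

text \<open>
  The step from \<open>p\<^sub>k = \<delta>\<^sub>k + X s\<^sub>k\<close> to \<open>p\<^bsub>k+1\<^esub>\<close> multiplies by \<open>-\<theta>\<^sub>k X\<close> and adds terms of lower degree, so the leading coefficient is, up to
  sign, the product of the \<open>\<theta>\<^sub>k\<close>.
\<close>
lemma lead_coeff_lanczos_y_poly:
  assumes "\<forall>k<m. \<theta> k \<noteq> 0" "k < m"
  shows "coeff (lanczos_y_poly H c \<theta> (Suc k)) k \<noteq> 0"
  using assms
proof (induction k)
  case (Suc k)
  then show ?case
    using coeff_lanczos_y_poly_eq_0[of "Suc k" "Suc k"] coeff_lanczos_y_poly_eq_0[of k "Suc k"] by simp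
qed simp

context symmetric_krylov
begin

text \<open>
  Both identities are proved together since the recursion of \<open>y\<^sub>k\<close> refers to \<open>q\<^sub>k\<close>.  The constant
  coefficient of the polynomial of \<open>q\<^sub>k\<close> reproduces the recursion of \<open>\<delta>\<^sub>k\<close>.
\<close>
lemma lanczos_qy_as_poly:
  "lanczos_q H c \<theta> k = P (pCons (lanczos_delta H c \<theta> k) (lanczos_y_poly H c \<theta> k)) \<and>
   lanczos_y n H c \<theta> k = P (lanczos_y_poly H c \<theta> k)"
proof (induction k rule: less_induct)
  case (less k)
  let ?p = "\<lambda>k. pCons (lanczos_delta H c \<theta> k) (lanczos_y_poly H c \<theta> k)"
  have HP: "H *\<^sub>v P p = P (pCons 0 p)" for p
    using H c by (intro eq_vecI) auto
  show ?case
  proof (cases "(H, c, \<theta>, k)" rule: lanczos_y_poly.cases)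
    case 1
    then have k: "k = 0"
      by simp
    show ?thesis
      unfolding k using H c by (auto simp: mult_mat_zero_vec[OF H])
  next
    case 2
    then have k: "k = Suc 0"
      by simp
    have q0: "lanczos_q H c \<theta> 0 = P (?p 0)"
      using less.IH[of 0] k by blast
    have y0: "lanczos_y n H c \<theta> 0 = P (lanczos_y_poly H c \<theta> 0)"
      using less.IH[of 0] k by blast
    have "lanczos_q H c \<theta> k = P (Polynomial.smult (\<theta> 0)
        (- pCons 0 (?p 0) + Polynomial.smult (lanczos_alpha H c \<theta> 0) (?p 0)))"
      unfolding k lanczos_q.simps(2) lanczos_alpha_def[symmetric]
      unfolding q0
      by (simp only: P_add P_smult P_uminus HP)
    also have "Polynomial.smult (\<theta> 0) (- pCons 0 (?p 0) + Polynomial.smult (lanczos_alpha H c \<theta> 0) (?p 0)) = ?p k"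
      by (simp add: k algebra_simps)
    finally show ?thesis
      unfolding k lanczos_y.simps(2) q0 y0 lanczos_y_poly.simps(2)
      by (simp only: P_add P_smult P_uminus)
  next
    case (3 _ _ _ l)
    then have k: "k = Suc (Suc l)"
      by simp
    have q1: "lanczos_q H c \<theta> (Suc l) = P (?p (Suc l))" and q0: "lanczos_q H c \<theta> l = P (?p l)"
      using less.IH k by auto
    have y1: "lanczos_y n H c \<theta> (Suc l) = P (lanczos_y_poly H c \<theta> (Suc l))"
      and y0: "lanczos_y n H c \<theta> l = P (lanczos_y_poly H c \<theta> l)"
      using less.IH k by auto
    have "lanczos_q H c \<theta> k = P (Polynomial.smult (\<theta> (Suc l))
        (- pCons 0 (?p (Suc l)) + Polynomial.smult (lanczos_alpha H c \<theta> (Suc l)) (?p (Suc l))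
          + Polynomial.smult (lanczos_beta H c \<theta> l) (?p l)))"
      unfolding k lanczos_q.simps(3) lanczos_alpha_def[symmetric] lanczos_beta_def[symmetric]
      unfolding q1 q0
      by (simp only: P_add P_smult P_uminus HP)
    also have "Polynomial.smult (\<theta> (Suc l))
        (- pCons 0 (?p (Suc l)) + Polynomial.smult (lanczos_alpha H c \<theta> (Suc l)) (?p (Suc l))
          + Polynomial.smult (lanczos_beta H c \<theta> l) (?p l)) = ?p k"
      by (simp add: k)
    finally show ?thesis
      unfolding k lanczos_y.simps(3) q1 y1 y0 lanczos_y_poly.simps(3)
      by (simp only: P_add P_smult P_uminus)
  qed
qed

lemmas lanczos_q_as_poly = lanczos_qy_as_poly[THEN conjunct1]
lemmas lanczos_y_as_poly = lanczos_qy_as_poly[THEN conjunct2]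

lemma lanczos_q_carrier [simp]: "lanczos_q H c \<theta> k \<in> carrier_vec n"
  unfolding lanczos_q_as_poly by (rule P_carrier)

section \<open>Orthogonality and termination\<close>

text \<open>
  The three-term recursion tested against a vector.  In this form the first step, where the term with
  \<open>\<beta>\<close> is absent, needs no separate treatment.
\<close>
lemma scalar_prod_lanczos_q_Suc:
  assumes w: "w \<in> carrier_vec n"
  shows "lanczos_q H c \<theta> (Suc k) \<bullet> w = \<theta> k * (- ((H *\<^sub>v lanczos_q H c \<theta> k) \<bullet> w)
    + lanczos_alpha H c \<theta> k * (lanczos_q H c \<theta> k \<bullet> w)
    + (if k = 0 then 0 else lanczos_beta H c \<theta> (k - 1) * (lanczos_q H c \<theta> (k - 1) \<bullet> w)))"
proof -
  have q: "lanczos_q H c \<theta> k \<in> carrier_vec n" "H *\<^sub>v lanczos_q H c \<theta> k \<in> carrier_vec n" for k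
    using H by (auto intro: mult_mat_vec_carrier)
  show ?thesis
  proof (cases k)
    case 0
    then show ?thesis
      using w q[of 0]
      by (simp del: lanczos_q.simps(1) add: lanczos_alpha_def
          add_scalar_prod_distrib[of _ n] carrier_vecD[OF w] carrier_matD[OF H])
  next
    case (Suc l)
    then show ?thesis
      using w q[of l] q[of "Suc l"]
      by (simp del: lanczos_q.simps(1,2) lanczos_q.simps(3)[of H c \<theta> "l - 1"]
        add: lanczos_q.simps(3)[of H c \<theta> l] lanczos_alpha_def lanczos_beta_def
          add_scalar_prod_distrib[of _ n] carrier_vecD[OF w] carrier_matD[OF H])
  qed
qed

text \<open>
  The coefficients \<open>\<alpha>\<^sub>k\<close> and \<open>\<beta>\<^bsub>k-1\<^esub>\<close> are chosen so that \<open>q\<^bsub>k+1\<^esub>\<close> is orthogonal to \<open>q\<^sub>k\<close> and \<open>q\<^bsub>k-1\<^esub>\<close>.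
  Orthogonality to the earlier vectors comes for free from the symmetry of \<open>H\<close>.
\<close>
lemma lanczos_q_orthogonal:
  assumes \<theta>: "\<forall>k<m. \<theta> k \<noteq> 0" and nz: "\<And>k. k < m \<Longrightarrow> lanczos_q H c \<theta> k \<noteq> 0\<^sub>v n"
    and "j \<le> m" "i < j"
  shows "lanczos_q H c \<theta> i \<bullet> lanczos_q H c \<theta> j = 0"
  using assms(3,4)
proof (induction j arbitrary: i rule: less_induct)
  case (less j)
  let ?q = "lanczos_q H c \<theta>"
  obtain k where j: "j = Suc k"
    using less.prems by (cases j) auto
  have sym: "?q a \<bullet> ?q b = ?q b \<bullet> ?q a" for a b
    by (rule comm_scalar_prod[of _ n]) auto
  have Hsym: "(H *\<^sub>v ?q a) \<bullet> ?q b = ?q a \<bullet> (H *\<^sub>v ?q b)" for a b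
    by (rule scalar_prod_symmetric_mat[OF H H_sym]) auto
  have orth: "?q a \<bullet> ?q b = 0" if "a \<le> k" "b \<le> k" "a \<noteq> b" for a b
  proof (cases "a < b")
    case True
    then show ?thesis
      using less.IH[of b a] that less.prems j by simp
  next
    case False
    then show ?thesis
      using less.IH[of a b] that less.prems j sym[of a b] by simp
  qed
  have qq: "?q a \<bullet> ?q a \<noteq> 0" if "a < m" for a
    using nz[OF that] scalar_prod_self_eq_0_real[of "?q a" n] by auto
  have alpha: "lanczos_alpha H c \<theta> a * (?q a \<bullet> ?q a) = ?q a \<bullet> (H *\<^sub>v ?q a)" if "a < m" for a
    using qq[OF that] by (simp add: lanczos_alpha_def lanczos_ratio_def)
  have beta: "lanczos_beta H c \<theta> a * (?q a \<bullet> ?q a) = ?q a \<bullet> (H *\<^sub>v ?q (Suc a))" if "a < m" for a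
    using qq[OF that] by (simp add: lanczos_beta_def lanczos_ratio_def)
  have rec: "?q j \<bullet> ?q i = \<theta> k * (- ((H *\<^sub>v ?q k) \<bullet> ?q i)
    + lanczos_alpha H c \<theta> k * (?q k \<bullet> ?q i)
    + (if k = 0 then 0 else lanczos_beta H c \<theta> (k - 1) * (?q (k - 1) \<bullet> ?q i)))"
    unfolding j by (rule scalar_prod_lanczos_q_Suc) simp
  consider "i = k" | "Suc i = k" | "Suc i < k"
    using less.prems j by linarith
  then have "?q j \<bullet> ?q i = 0"
  proof cases
    case 1
    then show ?thesis
      using rec orth[of "k - 1" k] alpha[of k] Hsym[of k k] less.prems j
      by (auto simp: algebra_simps)
  next
    case 2
    then show ?thesis
      using rec orth[of k i] beta[of i] Hsym[of k i] Hsym[of i k] less.prems j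
        comm_scalar_prod[of "?q i" n "H *\<^sub>v ?q k"] H
      by (auto simp: algebra_simps)
  next
    case 3
    \<comment> \<open>Since \<open>\<theta>\<^sub>i \<noteq> 0\<close>, the recursion expresses \<open>H q\<^sub>i\<close> by \<open>q\<close> vectors of index at most \<open>i + 1 < k\<close>,
      all orthogonal to \<open>q\<^sub>k\<close>.\<close>
    have "?q (Suc i) \<bullet> ?q k = 0" "?q i \<bullet> ?q k = 0" "i \<noteq> 0 \<Longrightarrow> ?q (i - 1) \<bullet> ?q k = 0"
      using 3 by (auto intro!: orth)
    then have "(H *\<^sub>v ?q i) \<bullet> ?q k = 0"
      using scalar_prod_lanczos_q_Suc[of "?q k" \<theta> i] \<theta> 3 less.prems j
      by (auto split: if_splits)
    then have "(H *\<^sub>v ?q k) \<bullet> ?q i = 0"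
      using Hsym[of i k] comm_scalar_prod[of "?q i" n "H *\<^sub>v ?q k"] Hsym[of k i] H by simp
    then show ?thesis
      using rec orth[of k i] orth[of "k - 1" i] 3 by simp
  qed
  then show ?case
    using sym[of i j] by simp
qed

text \<open>
  The polynomials of \<open>q\<^sub>0, \<dots>, q\<^bsub>m-1\<^esub>\<close> have all degrees below \<open>m\<close>, so these vectors span the \<open>m\<close>-th Krylov
  space: the leading term of \<open>p\<close> is removed by subtracting a multiple of the last one.
\<close>
lemma orthogonal_to_krylov:
  assumes \<theta>: "\<forall>k<m. \<theta> k \<noteq> 0" and w: "w \<in> carrier_vec n"
    and orth: "\<And>i. i < m \<Longrightarrow> lanczos_q H c \<theta> i \<bullet> w = 0"
    and p: "\<And>i. m \<le> i \<Longrightarrow> coeff p i = 0"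
  shows "P p \<bullet> w = 0"
  using assms
proof (induction m arbitrary: p)
  case 0
  then have "p = 0"
    by (auto intro: poly_eqI)
  then show ?case
    using w by simp
next
  case (Suc m)
  let ?p = "pCons (lanczos_delta H c \<theta> m) (lanczos_y_poly H c \<theta> m)"
  have lc: "coeff ?p m \<noteq> 0"
    using lead_coeff_lanczos_y_poly[of "Suc m" \<theta> "m - 1" H c] Suc.prems(1) by (cases m) auto
  have hi: "coeff ?p i = 0" if "m < i" for i
    using that coeff_lanczos_y_poly_eq_0[of m "i - 1" H c \<theta>] by (cases i) auto
  let ?a = "coeff p m / coeff ?p m"
  have "P (p - Polynomial.smult ?a ?p) \<bullet> w = 0"
  proof (rule Suc.IH)
    show "coeff (p - Polynomial.smult ?a ?p) i = 0" if "m \<le> i" for i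
      unfolding coeff_diff coeff_smult
      using that lc hi[of i] Suc.prems(4)[of i] by (cases "i = m") simp_all
  qed (use Suc.prems in auto)
  moreover have "P ?p \<bullet> w = 0"
    using Suc.prems(3)[of m] by (simp only: lanczos_q_as_poly)
  moreover have "P p = P (p - Polynomial.smult ?a ?p) + ?a \<cdot>\<^sub>v P ?p"
    by (simp only: P_add[symmetric] P_smult[symmetric]) simp
  ultimately show ?case
    using w by (simp only: add_scalar_prod_distrib[OF P_carrier smult_carrier_vec[THEN iffD2, OF P_carrier]]
      smult_scalar_prod_distrib[OF P_carrier])
qed

text \<open>
  \<open>q\<^sub>r\<close> is orthogonal to the \<open>r\<close>-th Krylov space and, as that space is stationary, belongs to it.  The
  orthogonality uses \<open>q\<^sub>k \<noteq> 0\<close> for \<open>k < r\<close>, which holds because the polynomial of \<open>q\<^sub>k\<close> has degree \<open>k\<close>.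
\<close>
lemma lanczos_q_krylov_index:
  assumes c_nz: "c \<noteq> 0\<^sub>v n" and \<theta>: "\<forall>k<krylov_index n H c. \<theta> k \<noteq> 0"
  shows "lanczos_q H c \<theta> (krylov_index n H c) = 0\<^sub>v n"
proof -
  let ?r = "krylov_index n H c" and ?q = "lanczos_q H c \<theta>"
  let ?p = "\<lambda>k. pCons (lanczos_delta H c \<theta> k) (lanczos_y_poly H c \<theta> k)"
  have hi: "coeff (?p k) i = 0" if "k < i" for k i
    using that coeff_lanczos_y_poly_eq_0[of k "i - 1" H c \<theta>] by (cases i) auto
  have nz: "?q k \<noteq> 0\<^sub>v n" if k: "k < ?r" for k
  proof
    assume "?q k = 0\<^sub>v n"
    then have "P (?p k) = 0\<^sub>v n"
      by (simp only: lanczos_q_as_poly)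
    then have "?p k = 0"
      by (rule P_eq_0_imp_eq_0[OF c_nz]) (use hi k in auto)
    then have "coeff (?p k) k = 0"
      by (metis coeff_0)
    then show False
      using lead_coeff_lanczos_y_poly[OF \<theta>, of "k - 1" H c] k by (cases k) auto
  qed
  have "?q ?r \<in> krylov n H c (Suc ?r)"
    unfolding lanczos_q_as_poly by (rule in_krylovI) (use hi in simp)
  then have "?q ?r \<in> krylov n H c ?r"
    using krylov_index_stationary[OF c_nz] by simp
  then obtain g where g: "?q ?r = P g" "\<forall>i\<ge>?r. coeff g i = 0"
    by (auto simp: krylov_eq_image)
  have "P g \<bullet> ?q ?r = 0"
    by (rule orthogonal_to_krylov[OF \<theta>])
      (use g(2) lanczos_q_orthogonal[OF \<theta> nz, of ?r] in auto)
  then show ?thesis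
    using scalar_prod_self_eq_0_real[of "?q ?r" n] g(1) by simp
qed

end

section \<open>Compatible and incompatible systems\<close>

theorem theorem3p1:
  fixes H Z :: "real mat" and c :: "real vec" and \<theta> :: "nat \<Rightarrow> real"
    and n d r :: nat and y :: "nat \<Rightarrow> real vec" and \<delta> :: "nat \<Rightarrow> real" and \<delta>\<^sub>1 :: real
  assumes H: "H \<in> carrier_mat n n"
    and H_sym: "transpose_mat H = H"
    and c: "c \<in> carrier_vec n"
    and c_nz: "c \<noteq> 0\<^sub>v n"
    and r_def: "r = krylov_index n H c"
    and theta: "\<forall>k<r. \<theta> k \<noteq> 0"
    and y_def: "y = lanczos_y n H c \<theta>"
    and delta_def: "\<delta> = lanczos_delta H c \<theta>"
    and delta1_def: "\<delta>\<^sub>1 = lanczos_coeff n H c \<theta> r 1"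
    and Z: "orthonormal_null_basis n d H Z"
  shows "(\<delta> r \<noteq> 0 \<longrightarrow>
            (let x\<^sub>r = (1 / \<delta> r) \<cdot>\<^sub>v y r in
               x\<^sub>r \<in> carrier_vec n \<and> H *\<^sub>v x\<^sub>r + c = 0\<^sub>v n) \<and>
            c \<in> mat_range H \<and>
            (\<forall>k\<le>r. transpose_mat Z *\<^sub>v y k = 0\<^sub>v d)) \<and>
         (\<delta> r = 0 \<longrightarrow>
            y r = \<delta>\<^sub>1 \<cdot>\<^sub>v ((Z * transpose_mat Z) *\<^sub>v c) \<and>
            \<delta>\<^sub>1 \<noteq> 0 \<and>
            transpose_mat Z *\<^sub>v c \<noteq> 0\<^sub>v d \<and>
            c \<notin> mat_range H \<and>
            \<not> (\<exists>x \<in> carrier_vec n. H *\<^sub>v x + c = 0\<^sub>v n) \<and>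
            (\<exists>y1 \<in> krylov n H c (r - 1).
               y r = H *\<^sub>v y1 + \<delta>\<^sub>1 \<cdot>\<^sub>v c \<and>
               (let x1 = (1 / \<delta>\<^sub>1) \<cdot>\<^sub>v y1 in
                  H *\<^sub>v (H *\<^sub>v x1 + c) = 0\<^sub>v n \<and>
                  is_arg_min (\<lambda>x. (vec_norm2 (H *\<^sub>v x + c))\<^sup>2) (\<lambda>x. x \<in> carrier_vec n) x1)))"
proof -
  interpret symmetric_krylov n H c
    by unfold_locales (rule H H_sym c)+
  let ?s = "lanczos_y_poly H c \<theta>"
  have Zc: "Z \<in> carrier_mat n d"
    using Z by (simp add: orthonormal_null_basis_def)
  have ZH: "transpose_mat Z *\<^sub>v (H *\<^sub>v x) = 0\<^sub>v d" if "x \<in> carrier_vec n" for x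
    by (rule orthonormal_null_basis_transpose_mult[OF H H_sym Z that])
  have r_pos: "0 < r"
    using krylov_index_pos[OF c_nz] by (simp add: r_def)
  have y: "y k = P (?s k)" for k
    by (simp add: y_def lanczos_y_as_poly)
  have s_hi: "coeff (?s r) i = 0" if "r \<le> i" for i
    by (rule coeff_lanczos_y_poly_eq_0[OF that])
  have s_lead: "coeff (?s r) (r - 1) \<noteq> 0"
    using lead_coeff_lanczos_y_poly[OF theta, of "r - 1"] r_pos by simp
  have delta1: "\<delta>\<^sub>1 = coeff (?s r) 0"
    using krylov_coeff_P[OF c_nz, of "?s r" 1] s_hi r_pos
    by (simp add: delta1_def lanczos_coeff_def lanczos_y_as_poly r_def)
  have q_r: "\<delta> r \<cdot>\<^sub>v c + H *\<^sub>v y r = 0\<^sub>v n"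
    using lanczos_q_krylov_index[OF c_nz, of \<theta>] theta
    by (simp add: lanczos_q_as_poly y delta_def r_def)
  have in_range: "\<exists>x \<in> carrier_vec n. c = H *\<^sub>v x" if "x \<in> carrier_vec n" "H *\<^sub>v x + c = 0\<^sub>v n" for x
  proof -
    have "c = H *\<^sub>v (- x)"
    proof (rule eq_vecI)
      fix i assume "i < dim_vec (H *\<^sub>v (- x))"
      then have i: "i < n"
        using H by simp
      have "(H *\<^sub>v x + c) $ i = 0"
        using that(2) i by simp
      then show "c $ i = (H *\<^sub>v (- x)) $ i"
        using H c that(1) i by (auto simp: scalar_prod_uminus_right)
    qed (use H c in auto)
    then show ?thesis
      using that(1) by (intro bexI[of _ "- x"]) auto
  qed
  have solvable_imp: "transpose_mat Z *\<^sub>v c = 0\<^sub>v d" if "x \<in> carrier_vec n" "c = H *\<^sub>v x" for x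
    using ZH[OF that(1)] that(2) by simp
  show ?thesis
  proof (intro conjI impI)
    assume nz: "\<delta> r \<noteq> 0"
    let ?x = "(1 / \<delta> r) \<cdot>\<^sub>v y r"
    have x: "?x \<in> carrier_vec n"
      by (simp add: y)
    have sol: "H *\<^sub>v ?x + c = 0\<^sub>v n"
    proof -
      have "H *\<^sub>v ?x + c = (1 / \<delta> r) \<cdot>\<^sub>v (\<delta> r \<cdot>\<^sub>v c + H *\<^sub>v y r)"
        using H c nz mult_mat_vec[OF H, of "y r" "1 / \<delta> r"]
        by (intro eq_vecI) (auto simp: y field_simps)
      then show ?thesis
        unfolding q_r by auto
    qed
    show "let x\<^sub>r = ?x in x\<^sub>r \<in> carrier_vec n \<and> H *\<^sub>v x\<^sub>r + c = 0\<^sub>v n"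
      using x sol by simp
    obtain z where z: "z \<in> carrier_vec n" "c = H *\<^sub>v z"
      using in_range[OF x sol] by blast
    show "c \<in> mat_range H"
      using z H by (auto simp: mat_range_def)
    have Zc0: "transpose_mat Z *\<^sub>v c = 0\<^sub>v d"
      by (rule solvable_imp[OF z])
    \<comment> \<open>Every \<open>p(H)c\<close> is a multiple of \<open>c\<close> plus a vector in the range of \<open>H\<close>.\<close>
    have "transpose_mat Z *\<^sub>v P p = 0\<^sub>v d" for p
    proof (cases p)
      case (pCons a p')
      have "transpose_mat Z *\<^sub>v P p
          = a \<cdot>\<^sub>v (transpose_mat Z *\<^sub>v c) + transpose_mat Z *\<^sub>v (H *\<^sub>v P p')"
        using Zc H c mult_mat_vec[of "transpose_mat Z" d n c a]
        by (simp add: pCons mult_add_distrib_mat_vec[of _ d n])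
      then show ?thesis
        using Zc0 ZH[OF P_carrier] by auto
    qed
    then show "\<forall>k\<le>r. transpose_mat Z *\<^sub>v y k = 0\<^sub>v d"
      by (simp add: y)
  next
    assume z: "\<delta> r = 0"
    obtain t where t: "?s r = pCons \<delta>\<^sub>1 t"
      using delta1 by (cases "?s r") auto
    have t_hi: "coeff t i = 0" if "r - 1 \<le> i" for i
      using s_hi[of "Suc i"] that by (simp add: t)
    have Hy: "H *\<^sub>v y r = 0\<^sub>v n"
      using q_r z H by (simp add: y)
    have y_nz: "y r \<noteq> 0\<^sub>v n"
      using P_eq_0_imp_eq_0[OF c_nz, of "?s r"] s_hi s_lead by (auto simp: y r_def)
    have y_t: "y r = H *\<^sub>v P t + \<delta>\<^sub>1 \<cdot>\<^sub>v c"
      using H c by (auto simp: y t intro!: comm_add_vec[of _ n])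
    \<comment> \<open>Otherwise \<open>y\<^sub>r\<close> lies in both the null space and the range of \<open>H\<close>, hence vanishes.\<close>
    show d1: "\<delta>\<^sub>1 \<noteq> 0"
    proof
      assume "\<delta>\<^sub>1 = 0"
      then have y': "y r = H *\<^sub>v P t"
        using y_t H c by auto
      then have "H *\<^sub>v P t = 0\<^sub>v n"
        using symmetric_mat_square_kernel[OF H H_sym P_carrier] Hy by simp
      then show False
        using y' y_nz by simp
    qed
    have Zy: "transpose_mat Z *\<^sub>v y r = \<delta>\<^sub>1 \<cdot>\<^sub>v (transpose_mat Z *\<^sub>v c)"
    proof -
      have "transpose_mat Z *\<^sub>v y r
          = transpose_mat Z *\<^sub>v (H *\<^sub>v P t) + \<delta>\<^sub>1 \<cdot>\<^sub>v (transpose_mat Z *\<^sub>v c)"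
        using Zc H c mult_mat_vec[of "transpose_mat Z" d n c \<delta>\<^sub>1]
        by (simp add: y_t mult_add_distrib_mat_vec[of _ d n])
      then show ?thesis
        using Zc c by (auto simp: ZH)
    qed
    have proj: "(Z * transpose_mat Z) *\<^sub>v y r = y r"
      using orthonormal_null_basis_projection[OF H Z _ Hy] by (simp add: y)
    have yr: "y r \<in> carrier_vec n"
      by (simp add: y)
    show y_eq: "y r = \<delta>\<^sub>1 \<cdot>\<^sub>v ((Z * transpose_mat Z) *\<^sub>v c)"
    proof -
      have "y r = Z *\<^sub>v (transpose_mat Z *\<^sub>v y r)"
        using proj Zc yr by (simp add: assoc_mult_mat_vec[of _ n d _ n])
      also have "\<dots> = \<delta>\<^sub>1 \<cdot>\<^sub>v (Z *\<^sub>v (transpose_mat Z *\<^sub>v c))"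
        unfolding Zy using Zc c by (intro mult_mat_vec[of _ n d]) auto
      also have "Z *\<^sub>v (transpose_mat Z *\<^sub>v c) = (Z * transpose_mat Z) *\<^sub>v c"
        using Zc c by (simp add: assoc_mult_mat_vec[of _ n d _ n])
      finally show ?thesis .
    qed
    show Zc_nz: "transpose_mat Z *\<^sub>v c \<noteq> 0\<^sub>v d"
    proof
      assume "transpose_mat Z *\<^sub>v c = 0\<^sub>v d"
      then have "(Z * transpose_mat Z) *\<^sub>v c = 0\<^sub>v n"
        using Zc c by (auto simp: assoc_mult_mat_vec[of _ n d _ n])
      then show False
        using y_eq y_nz by auto
    qed
    show "c \<notin> mat_range H"
      using Zc_nz solvable_imp H by (auto simp: mat_range_def)
    show "\<not> (\<exists>x \<in> carrier_vec n. H *\<^sub>v x + c = 0\<^sub>v n)"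
      using Zc_nz solvable_imp in_range by blast
    \<comment> \<open>The residual of \<open>t(H)c / \<delta>\<^sub>1\<close> is a multiple of \<open>y\<^sub>r\<close>, hence in the null space.\<close>
    have res: "H *\<^sub>v (H *\<^sub>v ((1 / \<delta>\<^sub>1) \<cdot>\<^sub>v P t) + c) = 0\<^sub>v n"
    proof -
      have "H *\<^sub>v ((1 / \<delta>\<^sub>1) \<cdot>\<^sub>v P t) + c = (1 / \<delta>\<^sub>1) \<cdot>\<^sub>v y r"
        using H c d1 mult_mat_vec[OF H P_carrier, of "1 / \<delta>\<^sub>1" t]
        by (intro eq_vecI) (auto simp: y_t field_simps)
      then show ?thesis
        using mult_mat_vec[OF H yr, of "1 / \<delta>\<^sub>1"] Hy by auto
    qed
    show "\<exists>y1 \<in> krylov n H c (r - 1).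
               y r = H *\<^sub>v y1 + \<delta>\<^sub>1 \<cdot>\<^sub>v c \<and>
               (let x1 = (1 / \<delta>\<^sub>1) \<cdot>\<^sub>v y1 in
                  H *\<^sub>v (H *\<^sub>v x1 + c) = 0\<^sub>v n \<and>
                  is_arg_min (\<lambda>x. (vec_norm2 (H *\<^sub>v x + c))\<^sup>2) (\<lambda>x. x \<in> carrier_vec n) x1)"
      unfolding Let_def
      using y_t res in_krylovI[OF t_hi]
        normal_equations_imp_least_squares[OF H H_sym c smult_carrier_vec[THEN iffD2, OF P_carrier] res]
      by blast
  qed
qed

end
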